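(* The following integral representation holds true for the generalized hypergeometric-Mittag-Leffler functions ${}_{{}_qF_q}E_{(\alpha,\beta)}(a_1,\dots,a_q;b_1,\dots,b_q;u)$, with $\alpha,\beta\in\mathbb{R}^{+}$: $$\int_{-\infty}^{\infty}e^{-\delta u^2}\;{}_{{}_qF_q}E_{(\alpha,\beta)}(a_1,\dots,a_q;b_1,\dots,b_q;u)\,du$$ $$=\sqrt{\frac{\pi}{\delta}}\;\;{}_{{}_{2q+1}F_{2q}}E_{(2\alpha,\beta)}\!\left(\frac{a_1}{2},\frac{a_1+1}{2},\dots,\frac{a_q}{2},\frac{a_q+1}{2},\frac12;\;\frac{b_1}{2},\frac{b_1+1}{2},\dots,\frac{b_q}{2},\frac{b_q+1}{2};\;\frac{1}{\delta}\right).$$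
   Context: $(a)_r=\Gamma(a+r)/\Gamma(a)$ is the Pochhammer symbol. The generalized hypergeometric-Mittag-Leffler functions are given by $${}_{{}_pF_q}E_{(\alpha,\beta)}(a_1,\dots,a_p;b_1,\dots,b_q;u)=\sum_{r=0}^{\infty}\frac{(a_1)_r\cdots(a_p)_r}{(b_1)_r\cdots(b_q)_r}\,\frac{u^r}{\Gamma(\alpha r+\beta)} .$$
   Formalization: The formal theorem takes δ real and positive, no b_i a non-positive integer, and assumes the series on the right converges; for α<1/2 (e.g. q=0, α=1/4, β=δ=1) that series generally diverges, so the identity has no meaning there. *)

theory Defs
  imports "HOL-Analysis.Analysis"
begin

text \<open>
  The numerator and denominator parameters are lists of complex numbers. The library's
  \<^const>\<open>pochhammer\<close> is the rising factorial: it equals \<open>\<Gamma>(a + r) / \<Gamma>(a)\<close> unless \<open>a\<close> is a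
  non-positive integer (fact \<open>pochhammer_Gamma\<close>), where it is the usual continuous extension.
\<close>

definition hyp_ML_term ::
  "real \<Rightarrow> real \<Rightarrow> complex list \<Rightarrow> complex list \<Rightarrow> complex \<Rightarrow> nat \<Rightarrow> complex" where
  "hyp_ML_term \<alpha> \<beta> as bs u r =
     (\<Prod>a\<leftarrow>as. pochhammer a r) / (\<Prod>b\<leftarrow>bs. pochhammer b r)
       * (u ^ r / of_real (Gamma (\<alpha> * real r + \<beta>)))"

definition hyp_ML ::
  "real \<Rightarrow> real \<Rightarrow> complex list \<Rightarrow> complex list \<Rightarrow> complex \<Rightarrow> complex" where
  "hyp_ML \<alpha> \<beta> as bs u = (\<Sum>r. hyp_ML_term \<alpha> \<beta> as bs u r)"

definition halves :: "complex list \<Rightarrow> complex list" where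
  "halves as = concat (map (\<lambda>a. [a / 2, (a + 1) / 2]) as)"

end

theory Submission
  imports Defs "HOL-Probability.Distributions" "HOL-Real_Asymp.Real_Asymp"
begin

text \<open>
  Write \<open>c r\<close> for the quotient of Pochhammer products. Integrating term by term against the Gaussian
  kills the odd powers, and the duplication formula for Pochhammer symbols turns the even ones into
  the right-hand series. The interchange is justified once
  \<open>S r = \<bar>c r\<bar> \<Gamma>((r + 1) / 2) \<delta> powr (-(r + 1) / 2) / \<Gamma>(\<alpha> r + \<beta>)\<close>, the integral of the modulus of the
  \<open>r\<close>-th term, is summable. As \<open>S (2 k)\<close> is a multiple of the modulus of the \<open>k\<close>-th term on the right,
  this amounts to deducing absolute convergence from the assumed convergence there.

  Unless \<open>c\<close> vanishes eventually, log-convexity of \<open>\<Gamma>\<close> yields two-sided bounds for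
  \<open>S (r + 1) / S r\<close>, of order \<open>r powr (1/2 - \<alpha>)\<close>. The ratio test then gives summability for
  \<open>\<alpha> > 1/2\<close> and for \<open>\<alpha> = 1/2\<close>, \<open>\<delta> > 1\<close>, and it contradicts the assumption for \<open>\<alpha> < 1/2\<close> and for
  \<open>\<alpha> = 1/2\<close>, \<open>\<delta> < 1\<close>. In the boundary case \<open>\<alpha> = 1/2\<close>, \<open>\<delta> = 1\<close> the right-hand terms are themselves a
  balanced quotient of Pochhammer symbols, so they behave like \<open>L k powr s\<close> with \<open>L \<noteq> 0\<close> and complex \<open>s\<close>;
  such a series converges only if \<open>Re s < -1\<close>, that is, only if it converges absolutely.
\<close>

section \<open>Two-sided bounds for shifted Gamma values\<close>

text \<open>Log-convexity between \<open>x\<close> and \<open>x + 1\<close>, with the functional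
  equation eliminating \<open>Gamma (x + 1)\<close>.\<close>

lemma Gamma_real_add_le:
  fixes x t :: real
  assumes "x > 0" "0 \<le> t" "t \<le> 1"
  shows "Gamma (x + t) \<le> x powr t * Gamma x"
proof -
  have "(ln \<circ> Gamma) ((1 - t) *\<^sub>R x + t *\<^sub>R (x + 1)) \<le> (1 - t) * (ln \<circ> Gamma) x + t * (ln \<circ> Gamma) (x + 1)"
    using assms by (intro convex_onD[OF log_convex_Gamma_real]) auto
  also have "(1 - t) *\<^sub>R x + t *\<^sub>R (x + 1) = x + t"
    by (simp add: algebra_simps)
  finally have "ln (Gamma (x + t)) \<le> (1 - t) * ln (Gamma x) + t * ln (Gamma (x + 1))"
    by simp
  also have "Gamma (x + 1) = x * Gamma x"
    using assms by (intro Gamma_plus1) auto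
  also have "(1 - t) * ln (Gamma x) + t * ln (x * Gamma x) = ln (x powr t * Gamma x)"
    using assms by (simp add: ln_mult ln_powr algebra_simps)
  finally show ?thesis
    using assms by (subst (asm) ln_le_cancel_iff) auto
qed

text \<open>Log-convexity again, now with \<open>x\<close> as the intermediate point between
  \<open>x - 1\<close> and \<open>x + t\<close>; this allows \<open>t\<close> to exceed 1.\<close>

lemma Gamma_real_add_ge:
  fixes x t :: real
  assumes "x > 1" "0 \<le> t"
  shows "(x - 1) powr t * Gamma x \<le> Gamma (x + t)"
proof -
  \<comment> \<open>The weight for which \<open>(1 - w) * (x - 1) + w * (x + t) = x\<close>.\<close>
  define w where "w = 1 / (1 + t)"
  have w: "0 \<le> w" "w \<le> 1" "w * (1 + t) = 1"
    using assms by (auto simp: w_def)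
  have "(ln \<circ> Gamma) ((1 - w) *\<^sub>R (x - 1) + w *\<^sub>R (x + t)) \<le> (1 - w) * (ln \<circ> Gamma) (x - 1) + w * (ln \<circ> Gamma) (x + t)"
    using assms w by (intro convex_onD[OF log_convex_Gamma_real]) auto
  also have "(1 - w) *\<^sub>R (x - 1) + w *\<^sub>R (x + t) = x"
    using w(3) by (simp add: algebra_simps)
  finally have "ln (Gamma x) \<le> (1 - w) * ln (Gamma (x - 1)) + w * ln (Gamma (x + t))"
    by simp
  hence "(1 + t) * ln (Gamma x) \<le> (1 + t) * ((1 - w) * ln (Gamma (x - 1)) + w * ln (Gamma (x + t)))"
    using assms by (intro mult_left_mono) auto
  also have "\<dots> = ((1 + t) - w * (1 + t)) * ln (Gamma (x - 1)) + w * (1 + t) * ln (Gamma (x + t))"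
    by (simp add: algebra_simps)
  also have "\<dots> = t * ln (Gamma (x - 1)) + ln (Gamma (x + t))"
    unfolding w(3) by simp
  finally have "(1 + t) * ln (Gamma x) - t * ln (Gamma (x - 1)) \<le> ln (Gamma (x + t))"
    by simp
  moreover have "Gamma x = (x - 1) * Gamma (x - 1)"
    using assms Gamma_plus1[of "x - 1"] nonpos_Ints_nonpos[of "x - 1"] by force
  hence "ln (Gamma x) = ln (x - 1) + ln (Gamma (x - 1))"
    using assms by (simp add: ln_mult_pos)
  ultimately have "ln ((x - 1) powr t * Gamma x) \<le> ln (Gamma (x + t))"
    using assms by (simp add: ln_mult_pos ln_powr algebra_simps)
  thus ?thesis
    using assms by (subst (asm) ln_le_cancel_iff) auto
qed

section \<open>Moments of the Gaussian weight\<close>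

text \<open>The half-line moments for \<delta> = 1 are rewritten from factorials to Gamma values,
  doubled by evenness, and rescaled by \<open>sqrt \<delta>\<close>.\<close>

lemma gaussian_abs_moment:
  fixes \<delta> :: real
  assumes "\<delta> > 0"
  shows "has_bochner_integral lborel (\<lambda>u. exp (- \<delta> * u\<^sup>2) * \<bar>u\<bar> ^ r)
           (Gamma ((real r + 1) / 2) / \<delta> powr ((real r + 1) / 2))"
proof -
  have half: "has_bochner_integral lborel (\<lambda>x::real. indicator {0..} x *\<^sub>R (exp (-x\<^sup>2) * \<bar>x\<bar> ^ r))
          (Gamma ((real r + 1) / 2) / 2)"
  proof (cases "even r")
    case True
    then obtain k where r: "r = 2 * k" by (elim evenE)
    have "Gamma (real k + 1/2) = sqrt pi * (fact (2 * k) / (2 ^ (2 * k) * fact k))"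
      using pochhammer_Gamma[of "1/2::real" k] fact_double[of k, where ?'a=real]
        nonpos_Ints_nonpos[of "1/2::real"]
      by (force simp: Gamma_one_half_real field_simps)
    then show ?thesis
      by (intro has_bochner_integral_cong[THEN iffD1, OF _ _ _ gaussian_moment_even_pos[of k]])
         (auto simp: r add_divide_distrib split: split_indicator)
  next
    case False
    then obtain k where r: "r = 2 * k + 1" by (elim oddE)
    have "Gamma (real k + 1) = fact k"
      using Gamma_fact[of k, where ?'a=real] by (simp add: add.commute)
    then show ?thesis
      by (intro has_bochner_integral_cong[THEN iffD1, OF _ _ _ gaussian_moment_odd_pos[of k]])
         (auto simp: r add_divide_distrib add.commute split: split_indicator)
  qed
  have "has_bochner_integral lborel (\<lambda>x::real. exp (-x\<^sup>2) * \<bar>x\<bar> ^ r) (Gamma ((real r + 1) / 2))"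
    using has_bochner_integral_even_function[OF half] by simp
  hence "has_bochner_integral lborel (\<lambda>x::real. exp (-(0 + sqrt \<delta> * x)\<^sup>2) * \<bar>0 + sqrt \<delta> * x\<bar> ^ r)
     (Gamma ((real r + 1) / 2) /\<^sub>R \<bar>sqrt \<delta>\<bar>)"
    using assms by (subst (asm) lborel_has_bochner_integral_real_affine_iff[of "sqrt \<delta>" _ _ 0]) auto
  hence "has_bochner_integral lborel (\<lambda>x::real. inverse (sqrt \<delta> ^ r) * (exp (-(0 + sqrt \<delta> * x)\<^sup>2) * \<bar>0 + sqrt \<delta> * x\<bar> ^ r))
     (inverse (sqrt \<delta> ^ r) * (Gamma ((real r + 1) / 2) /\<^sub>R \<bar>sqrt \<delta>\<bar>))"
    by (rule has_bochner_integral_mult_right)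
  also have "(\<lambda>x::real. inverse (sqrt \<delta> ^ r) * (exp (-(0 + sqrt \<delta> * x)\<^sup>2) * \<bar>0 + sqrt \<delta> * x\<bar> ^ r))
     = (\<lambda>u. exp (- \<delta> * u\<^sup>2) * \<bar>u\<bar> ^ r)"
    using assms by (auto simp: fun_eq_iff power_mult_distrib abs_mult field_simps)
  also have "\<delta> powr ((real r + 1) / 2) = sqrt \<delta> * sqrt \<delta> ^ r"
    using assms
    by (simp add: add_divide_distrib powr_add powr_half_sqrt powr_half_sqrt_powr powr_realpow
          real_sqrt_power)
  hence "inverse (sqrt \<delta> ^ r) * (Gamma ((real r + 1) / 2) /\<^sub>R \<bar>sqrt \<delta>\<bar>)
        = Gamma ((real r + 1) / 2) / \<delta> powr ((real r + 1) / 2)"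
    using assms by (simp add: field_simps)
  finally show ?thesis .
qed

lemma gaussian_odd_moment:
  fixes \<delta> :: real
  assumes "odd r"
  shows "(LINT u|lborel. exp (- \<delta> * u\<^sup>2) * u ^ r) = 0"
proof -
  have "(LINT u|lborel. exp (- \<delta> * u\<^sup>2) * u ^ r) = - (LINT u|lborel. exp (- \<delta> * u\<^sup>2) * u ^ r)"
    using lborel_integral_real_affine[of "-1" "\<lambda>u. exp (- \<delta> * u\<^sup>2) * u ^ r" 0] assms
    by simp
  thus ?thesis by simp
qed

section \<open>Absolute convergence of series with power-law terms\<close>

text \<open>The phase of \<open>n\<close> to the power \<open>s\<close> moves only logarithmically,
  too slowly for cancellation. So convergence forces \<open>Re s < -1\<close>, and the norms are
  then dominated by a multiple of \<open>n powr Re s\<close>.\<close>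

lemma summable_imp_abs_summable_asymp_power:
  fixes f g :: "nat \<Rightarrow> complex" and s L :: complex
  assumes f: "\<And>n. n > 0 \<Longrightarrow> f n = g n * exp (s * of_real (ln (real n)))"
    and g: "g \<longlonglongrightarrow> L" and L: "L \<noteq> 0" and summable: "summable f"
  shows "summable (\<lambda>n. norm (f n))"
proof -
  have norm_f: "norm (f n) = norm (g n) * real n powr Re s" if "n > 0" for n
    using that by (simp add: f norm_mult powr_def mult.commute)
  \<comment> \<open>With 1/16, late ratios \<open>g m / g n\<close> stay within (1/16 + 1/16) /
    (15/16) < 1/4 of 1.\<close>
  obtain N where N: "\<And>n. n \<ge> N \<Longrightarrow> norm (g n - L) < norm L / 16"
    using LIMSEQ_D[OF g, of "norm L / 16"] L by auto
  have g_ge: "norm (g n) \<ge> norm L * (15 / 16)" if "n \<ge> N" for n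
    using N[OF that] norm_triangle_ineq2[of L "g n"] by (simp add: norm_minus_commute)
  have g_le: "norm (g n) \<le> norm L * 2" if "n \<ge> N" for n
    using N[OF that] norm_triangle_ineq2[of "g n" L] norm_ge_zero[of L] by linarith
  have g_ratio: "norm (g m / g n - 1) \<le> 1 / 4" if "m \<ge> N" "n \<ge> N" for m n
  proof -
    have "g n \<noteq> 0" using g_ge[OF that(2)] L by auto
    hence "norm (g m / g n - 1) = norm ((g m - L) - (g n - L)) / norm (g n)"
      by (simp add: norm_divide[symmetric] diff_divide_distrib)
    also have "\<dots> \<le> (norm (g m - L) + norm (g n - L)) / norm (g n)"
      by (intro divide_right_mono norm_triangle_ineq4) auto
    also have "norm (g m - L) + norm (g n - L) \<le> 1 / 4 * norm (g n)"
      using N[OF that(1)] N[OF that(2)] g_ge[OF that(2)] norm_ge_zero[of L] by linarith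
    hence "(norm (g m - L) + norm (g n - L)) / norm (g n) \<le> 1 / 4"
      using \<open>g n \<noteq> 0\<close> by (simp add: divide_le_eq)
    finally show ?thesis .
  qed
  \<comment> \<open>Fixes the relative block length: for \<open>j < n / M\<close>,
    \<open>ln (1 + j / n) \<le> 1 / M < \<eta>\<close>, so the power factor also stays within 1/4 of
    1.\<close>
  have "isCont (\<lambda>t::real. exp (s * of_real t)) 0"
    by (intro continuous_intros)
  then obtain \<eta> where \<eta>: "\<eta> > 0" "\<And>t::real. \<bar>t\<bar> < \<eta> \<Longrightarrow> norm (exp (s * of_real t) - 1) < 1 / 4"
    unfolding continuous_at_eps_delta by (auto simp: dist_norm dest: spec[of _ "1/4"])
  obtain M :: nat where M: "M > 0" "1 / real M < \<eta>"
    using \<eta>(1) by (metis inverse_eq_divide reals_Archimedean zero_less_Suc)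
  \<comment> \<open>On a block \<open>{n..<n + n div M}\<close> the terms barely change, so the block sum has size comparable to
    \<open>n * norm (f n)\<close>; the Cauchy criterion forbids this if \<open>Re s \<ge> -1\<close>.\<close>
  have "Re s < -1"
  proof (rule ccontr)
    assume "\<not> Re s < -1"
    hence s: "Re s \<ge> -1" by simp
    \<comment> \<open>This is the lower bound \<open>k / 4 * (norm L / 2) / n\<close> for the block
      sum at \<open>n = M * k\<close>; \<open>k\<close> cancels, so \<open>e\<close> can be fixed
      before \<open>k\<close>.\<close>
    define e where "e = norm L / (8 * real M)"
    have "e > 0" using L M by (simp add: e_def)
    then obtain N' where N': "\<And>m n. m \<ge> N' \<Longrightarrow> norm (sum f {m..<n}) < e"
      using summable unfolding summable_Cauchy by blast
    define k where "k = N + N' + 1"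
    have "k > 0" by (simp add: k_def)
    define n where "n = M * k"
    have "k \<le> n" using M by (simp add: n_def)
    hence n: "n \<ge> N" "n \<ge> N'" "n > 0"
      by (auto simp: k_def)
    have fn: "f n \<noteq> 0" using g_ge[OF n(1)] n L by (auto simp: f)
    have Re_ratio: "1 / 4 \<le> Re (f (n + j) / f n)" if "j < k" for j
    proof -
      define t where "t = ln (real (n + j)) - ln (real n)"
      define x where "x = g (n + j) / g n"
      define y where "y = exp (s * of_real t)"
      have t_eq: "t = ln (1 + real j / real n)"
        unfolding t_def using n by (subst ln_divide_pos[symmetric]) (auto simp: field_simps)
      have "t \<ge> 0" unfolding t_eq by simp
      have "t \<le> real j / real n"
        unfolding t_eq by (rule ln_add_one_self_le_self) auto
      also have "\<dots> \<le> 1 / real M"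
        using that M n by (simp add: n_def field_simps)
      also note M(2)
      finally have y: "norm (y - 1) < 1 / 4"
        unfolding y_def using \<open>t \<ge> 0\<close> by (intro \<eta>(2)) auto
      have x: "norm (x - 1) \<le> 1 / 4"
        unfolding x_def using n by (intro g_ratio) auto
      have ratio: "f (n + j) / f n = x * y"
        using n by (simp add: f x_def y_def t_def exp_diff right_diff_distrib)
      have "x * y - 1 = (x - 1) * (y - 1) + (x - 1) + (y - 1)"
        by (simp add: algebra_simps)
      hence "norm (x * y - 1) \<le> norm (x - 1) * norm (y - 1) + norm (x - 1) + norm (y - 1)"
        by (metis norm_mult norm_triangle_le norm_triangle_ineq add_right_mono order.trans)
      also have "\<dots> \<le> 1 / 4 * (1 / 4) + 1 / 4 + 1 / 4"
        using x y by (intro add_mono mult_mono) auto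
      finally have "\<bar>Re (x * y - 1)\<bar> \<le> 3 / 4"
        using abs_Re_le_cmod[of "x * y - 1"] by linarith
      hence "1 / 4 \<le> Re (x * y)" unfolding minus_complex.sel one_complex.sel by linarith
      thus ?thesis unfolding ratio .
    qed
    have "real k / 4 = (\<Sum>j<k. 1 / 4)" by simp
    also have "\<dots> \<le> (\<Sum>j<k. Re (f (n + j) / f n))"
      by (intro sum_mono Re_ratio) auto
    also have "\<dots> = Re (\<Sum>j<k. f (n + j) / f n)" by simp
    also have "\<dots> \<le> norm (\<Sum>j<k. f (n + j) / f n)" by (rule complex_Re_le_cmod)
    also have "(\<Sum>j<k. f (n + j) / f n) = (\<Sum>j<k. f (n + j)) / f n"
      by (simp add: sum_divide_distrib)
    also have "(\<Sum>j<k. f (n + j)) = sum f {n..<n + k}"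
      using sum.shift_bounds_nat_ivl[of f 0 n k] by (simp add: lessThan_atLeast0 add.commute)
    finally have "real k / 4 * norm (f n) \<le> norm (sum f {n..<n + k})"
      using fn by (simp add: norm_divide field_simps)
    also have "\<dots> < e" using n by (intro N') auto
    finally have "real k / 4 * norm (f n) < e" .
    moreover have "norm (f n) \<ge> norm L / 2 * real n powr (-1)"
      unfolding norm_f[OF n(3)]
      using g_ge[OF n(1)] s n norm_ge_zero[of L] by (intro mult_mono powr_mono) (linarith | simp)+
    hence "real k / 4 * norm (f n) \<ge> real k / 4 * (norm L / 2 * real n powr (-1))"
      by (intro mult_left_mono) auto
    moreover have "real k / 4 * (norm L / 2 * real n powr (-1)) = e"
      using M \<open>k > 0\<close> by (simp add: e_def n_def powr_minus_divide)
    ultimately show False by simp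
  qed
  hence "summable (\<lambda>n. norm L * 2 * real n powr Re s)"
    by (intro summable_mult) (simp add: summable_real_powr_iff)
  \<comment> \<open>Starting at \<open>Suc N\<close> excludes \<open>n = 0\<close>, where
    \<open>f\<close> is unconstrained.\<close>
  thus ?thesis
  proof (rule summable_comparison_test'[where N = "Suc N"])
    fix n assume "n \<ge> Suc N"
    thus "norm (norm (f n)) \<le> norm L * 2 * real n powr Re s"
      using g_le[of n] by (simp add: norm_f mult_right_mono)
  qed
qed

section \<open>Quotients of Pochhammer products and their growth\<close>

definition pochhammer_quot :: "complex list \<Rightarrow> complex list \<Rightarrow> nat \<Rightarrow> complex" where
  "pochhammer_quot as bs r = (\<Prod>a\<leftarrow>as. pochhammer a r) / (\<Prod>b\<leftarrow>bs. pochhammer b r)"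

lemma pochhammer_quot_Nil: "pochhammer_quot [] [] r = 1"
  by (simp add: pochhammer_quot_def)

lemma pochhammer_quot_Cons:
  "pochhammer_quot (a # as) (b # bs) r = pochhammer a r / pochhammer b r * pochhammer_quot as bs r"
  by (simp add: pochhammer_quot_def)

lemma tendsto_add_of_nat_quot:
  "(\<lambda>r. (a + of_nat r) / (b + of_nat r) :: complex) \<longlonglongrightarrow> 1"
proof -
  have "(\<lambda>r. (a / of_nat r + 1) / (b / of_nat r + 1)) \<longlonglongrightarrow> (0 + 1) / (0 + 1 :: complex)"
    by (intro tendsto_intros lim_const_over_n) auto
  moreover have "eventually (\<lambda>r. (a / of_nat r + 1) / (b / of_nat r + 1) = (a + of_nat r) / (b + of_nat r)) sequentially"
    using eventually_gt_at_top[of 0]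
  proof eventually_elim
    case (elim r)
    hence "a / of_nat r + 1 = (a + of_nat r) / of_nat r" "b / of_nat r + 1 = (b + of_nat r) / of_nat r"
      by (simp_all add: field_simps)
    thus ?case using elim by simp
  qed
  ultimately show ?thesis
    by (simp add: tendsto_cong)
qed

text \<open>Each pair of parameters contributes \<open>(a + r) / (b + r)\<close>, which tends to 1.
  The product form stays meaningful when coefficients vanish.\<close>

lemma pochhammer_quot_ratio:
  assumes "length as = length bs"
  obtains \<rho> where "\<rho> \<longlonglongrightarrow> 1" "\<And>r. pochhammer_quot as bs (Suc r) = \<rho> r * pochhammer_quot as bs r"
proof -
  from assms have "\<exists>\<rho>. \<rho> \<longlonglongrightarrow> 1 \<and> (\<forall>r. pochhammer_quot as bs (Suc r) = \<rho> r * pochhammer_quot as bs r)"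
  proof (induction as bs rule: list_induct2)
    case Nil
    show ?case by (intro exI[of _ "\<lambda>_. 1"]) (simp add: pochhammer_quot_Nil)
  next
    case (Cons a as b bs)
    then obtain \<rho> where \<rho>: "\<rho> \<longlonglongrightarrow> 1" "\<And>r. pochhammer_quot as bs (Suc r) = \<rho> r * pochhammer_quot as bs r"
      by blast
    have "(\<lambda>r. (a + of_nat r) / (b + of_nat r) * \<rho> r) \<longlonglongrightarrow> 1"
      using tendsto_mult[OF tendsto_add_of_nat_quot \<rho>(1)] by simp
    thus ?case
      by (intro exI[of _ "\<lambda>r. (a + of_nat r) / (b + of_nat r) * \<rho> r"])
         (simp add: pochhammer_quot_Cons pochhammer_Suc \<rho>(2) mult_ac)
  qed
  thus ?thesis using that by blast
qed

text \<open>Since \<open>rGamma_series a\<close> tends to \<open>rGamma a\<close>,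
  \<open>pochhammer a (Suc n)\<close> behaves like \<open>rGamma a * fact n\<close> times
  \<open>n\<close> to the power \<open>a\<close>. The factorials cancel in pairs, and
  \<open>s\<close> is the sum of the differences \<open>a - b\<close>.\<close>

lemma pochhammer_quot_asymp:
  assumes "length as = length bs" "\<And>a. a \<in> set as \<Longrightarrow> a \<notin> \<int>\<^sub>\<le>\<^sub>0" "\<And>b. b \<in> set bs \<Longrightarrow> b \<notin> \<int>\<^sub>\<le>\<^sub>0"
  obtains g L s where "g \<longlonglongrightarrow> L" "L \<noteq> 0"
    "\<And>n. pochhammer_quot as bs (Suc n) = g n * exp (s * of_real (ln (real n)))"
proof -
  from assms have "\<exists>g L s. g \<longlonglongrightarrow> L \<and> L \<noteq> 0 \<and>
     (\<forall>n. pochhammer_quot as bs (Suc n) = g n * exp (s * of_real (ln (real n))))"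
  proof (induction as bs rule: list_induct2)
    case Nil
    show ?case
      by (intro exI[of _ "\<lambda>_. 1"] exI[of _ 1] exI[of _ 0]) (simp add: pochhammer_quot_Nil)
  next
    case (Cons a as b bs)
    then obtain g L s where g: "g \<longlonglongrightarrow> L" "L \<noteq> 0"
      "\<And>n. pochhammer_quot as bs (Suc n) = g n * exp (s * of_real (ln (real n)))"
      by auto
    have nz: "rGamma a \<noteq> 0" "rGamma b \<noteq> 0"
      using Cons.prems by (auto simp: rGamma_eq_zero_iff)
    have "(\<lambda>n. rGamma_series a n / rGamma_series b n * g n) \<longlonglongrightarrow> rGamma a / rGamma b * L"
      using nz by (intro tendsto_intros g)
    moreover have "rGamma a / rGamma b * L \<noteq> 0"
      using nz g(2) by simp
    moreover have "pochhammer_quot (a # as) (b # bs) (Suc n) =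
        rGamma_series a n / rGamma_series b n * g n * exp ((a - b + s) * of_real (ln (real n)))" for n
      by (simp add: pochhammer_quot_Cons g(3) rGamma_series_def ring_distribs exp_add exp_diff)
    ultimately show ?case by blast
  qed
  thus ?thesis using that by blast
qed

lemma pochhammer_quot_eventually_0:
  assumes "a \<in> set as" "a \<in> \<int>\<^sub>\<le>\<^sub>0"
  shows "eventually (\<lambda>r. pochhammer_quot as bs r = 0) sequentially"
proof -
  obtain k where k: "a = - of_nat k"
    using assms(2) by (elim nonpos_Ints_cases')
  show ?thesis
    using eventually_gt_at_top[of k]
  proof eventually_elim
    case (elim r)
    hence "pochhammer a r = 0"
      by (simp add: k pochhammer_of_nat_eq_0_iff)
    hence "(\<Prod>a\<leftarrow>as. pochhammer a r) = 0"
      using assms(1) by (force simp: prod_list_zero_iff)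
    thus ?case by (simp add: pochhammer_quot_def)
  qed
qed

lemma pochhammer_quot_nonzero:
  assumes "\<And>a. a \<in> set as \<Longrightarrow> a \<notin> \<int>\<^sub>\<le>\<^sub>0" "\<And>b. b \<in> set bs \<Longrightarrow> b \<notin> \<int>\<^sub>\<le>\<^sub>0"
  shows "pochhammer_quot as bs r \<noteq> 0"
  using assms
  by (auto simp: pochhammer_quot_def prod_list_zero_iff dest!: pochhammer_eq_0_imp_nonpos_Int)

text \<open>Either the coefficients terminate, or they follow a power law with nonzero constant.
  This serves the boundary case \<alpha> = 1/2, \<delta> = 1.\<close>

lemma summable_pochhammer_quot_imp_abs_summable:
  assumes "length as = length bs" "\<And>b. b \<in> set bs \<Longrightarrow> b \<notin> \<int>\<^sub>\<le>\<^sub>0"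
    and "summable (pochhammer_quot as bs)"
  shows "summable (\<lambda>r. norm (pochhammer_quot as bs r))"
proof (cases "\<exists>a\<in>set as. a \<in> \<int>\<^sub>\<le>\<^sub>0")
  case True
  then have "eventually (\<lambda>r. norm (pochhammer_quot as bs r) = 0) sequentially"
    using pochhammer_quot_eventually_0[of _ as bs] by auto
  thus ?thesis
    by (simp add: summable_cong[of _ "\<lambda>_. 0"])
next
  case False
  then obtain g L s where "g \<longlonglongrightarrow> L" "L \<noteq> 0"
    "\<And>n. pochhammer_quot as bs (Suc n) = g n * exp (s * of_real (ln (real n)))"
    using pochhammer_quot_asymp[of as bs] assms(1,2) by metis
  moreover have "summable (\<lambda>n. pochhammer_quot as bs (Suc n))"
    using assms(3) by (subst summable_Suc_iff)
  ultimately have "summable (\<lambda>n. norm (pochhammer_quot as bs (Suc n)))"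
    by (intro summable_imp_abs_summable_asymp_power[of _ g s L])
  thus ?thesis by (subst (asm) summable_Suc_iff)
qed

section \<open>Duplication and halved parameters\<close>

text \<open>Duplication at \<open>a / 2\<close>; each parameter contributes one factor
  \<open>4 ^ k\<close>.\<close>

lemma prod_list_halves:
  "(\<Prod>a\<leftarrow>halves as. pochhammer a k) = (\<Prod>a\<leftarrow>as. pochhammer a (2 * k)) / 4 ^ (k * length as)"
proof (induction as)
  case Nil
  show ?case by (simp add: halves_def)
next
  case (Cons a as)
  have "pochhammer a (2 * k) = 4 ^ k * (pochhammer (a / 2) k * pochhammer ((a + 1) / 2) k)"
    using pochhammer_double[of "a / 2" k] by (simp add: power_mult add_divide_distrib)
  thus ?case using Cons
    by (simp add: halves_def power_add)
qed

text \<open>Equal lengths make the powers of 4 cancel; hence the right-hand argument is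
  \<open>1 / \<delta>\<close> without a numerical factor.\<close>

lemma pochhammer_quot_halves:
  assumes "length as = length bs"
  shows "pochhammer_quot (halves as) (halves bs) k = pochhammer_quot as bs (2 * k)"
  using assms by (simp add: pochhammer_quot_def prod_list_halves)

lemma length_halves: "length (halves as) = 2 * length as"
  by (induction as) (auto simp: halves_def)

lemma halves_notin_nonpos_Ints:
  assumes "\<And>b. b \<in> set bs \<Longrightarrow> b \<notin> \<int>\<^sub>\<le>\<^sub>0" "b' \<in> set (halves bs)"
  shows "b' \<notin> \<int>\<^sub>\<le>\<^sub>0"
proof
  assume "b' \<in> \<int>\<^sub>\<le>\<^sub>0"
  then obtain k where k: "b' = - of_nat k" by (elim nonpos_Ints_cases')
  obtain b where b: "b \<in> set bs" "b' = b / 2 \<or> b' = (b + 1) / 2"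
    using assms(2) by (auto simp: halves_def)
  hence "b = 2 * b' \<or> b = 2 * b' - 1"
    by (force simp: field_simps)
  hence "b = - of_nat (2 * k) \<or> b = - of_nat (2 * k + 1)"
    unfolding k by (simp add: minus_diff_commute)
  hence "b \<in> \<int>\<^sub>\<le>\<^sub>0" by (metis minus_of_nat_in_nonpos_Ints)
  with assms(1) b(1) show False by blast
qed

section \<open>Pointwise absolute convergence of the left-hand series\<close>

lemma summable_ratio_tendsto:
  fixes f \<rho> :: "nat \<Rightarrow> real"
  assumes "\<And>r. f r \<ge> 0" "eventually (\<lambda>r. f (Suc r) \<le> \<rho> r * f r) sequentially" "\<rho> \<longlonglongrightarrow> l" "l < 1"
  shows "summable f"
proof -
  obtain c where c: "l < c" "c < 1" using dense[OF assms(4)] by blast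
  have "eventually (\<lambda>r. f (Suc r) \<le> c * f r) sequentially"
    using assms(2) order_tendstoD(2)[OF assms(3) c(1)]
  proof eventually_elim
    case (elim r)
    have "\<rho> r * f r \<le> c * f r" using elim assms(1)[of r] by (intro mult_right_mono) auto
    with elim show ?case by simp
  qed
  then obtain N where "\<And>r. r \<ge> N \<Longrightarrow> f (Suc r) \<le> c * f r"
    by (auto simp: eventually_sequentially)
  thus ?thesis
    using assms(1) c by (intro summable_ratio_test[of c N f]) auto
qed

lemma hyp_ML_term_eq:
  "hyp_ML_term \<alpha> \<beta> as bs u r = pochhammer_quot as bs r * (u ^ r / of_real (Gamma (\<alpha> * real r + \<beta>)))"
  by (simp add: hyp_ML_term_def pochhammer_quot_def)

text \<open>Reciprocal form of \<open>Gamma_real_add_ge\<close>; the decay of order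
  \<open>r powr (-\<alpha>)\<close> drives both upper ratio bounds below.\<close>

lemma Gamma_shift_quot_le:
  fixes \<alpha> \<beta> :: real
  assumes "\<alpha> > 0" "\<alpha> * real r + \<beta> > 1"
  shows "1 / Gamma (\<alpha> * real (Suc r) + \<beta>) \<le> (\<alpha> * real r + \<beta> - 1) powr (-\<alpha>) / Gamma (\<alpha> * real r + \<beta>)"
proof -
  define x where "x = \<alpha> * real r + \<beta>"
  have x: "x > 1" using assms by (simp add: x_def)
  have "(x - 1) powr \<alpha> * Gamma x \<le> Gamma (x + \<alpha>)"
    using assms x by (intro Gamma_real_add_ge) auto
  hence "1 / Gamma (x + \<alpha>) \<le> 1 / ((x - 1) powr \<alpha> * Gamma x)"
    using assms x by (intro divide_left_mono mult_pos_pos Gamma_real_pos) auto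
  thus ?thesis
    by (simp add: x_def powr_minus field_simps)
qed

text \<open>Ratios of successive norms are at most of order
  \<open>norm u * r powr (-\<alpha>)\<close>, which tends to 0 for every \<open>u\<close>.\<close>

lemma abs_summable_hyp_ML:
  assumes "\<alpha> > 0" "length as = length bs"
  shows "summable (\<lambda>r. norm (hyp_ML_term \<alpha> \<beta> as bs u r))"
proof -
  obtain \<rho> where \<rho>: "\<rho> \<longlonglongrightarrow> 1" "\<And>r. pochhammer_quot as bs (Suc r) = \<rho> r * pochhammer_quot as bs r"
    using pochhammer_quot_ratio[OF assms(2)] by blast
  define h where "h r = (\<alpha> * real r + \<beta> - 1) powr (-\<alpha>)" for r :: nat
  have h: "h \<longlonglongrightarrow> 0"
    unfolding h_def using assms(1) by real_asymp
  have "filterlim (\<lambda>r. \<alpha> * real r + \<beta>) at_top sequentially"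
    using assms(1) by real_asymp
  hence ev: "eventually (\<lambda>r. \<alpha> * real r + \<beta> > 1) sequentially"
    by (auto simp: filterlim_at_top_dense)
  show ?thesis
  proof (rule summable_ratio_tendsto)
    show "(\<lambda>r. norm (\<rho> r) * norm u * h r) \<longlonglongrightarrow> norm (1::complex) * norm u * 0"
      by (intro tendsto_intros \<rho> h)
    show "eventually (\<lambda>r. norm (hyp_ML_term \<alpha> \<beta> as bs u (Suc r))
            \<le> norm (\<rho> r) * norm u * h r * norm (hyp_ML_term \<alpha> \<beta> as bs u r)) sequentially"
      using ev
    proof eventually_elim
      case (elim r)
      have pos: "Gamma (\<alpha> * real r + \<beta>) > 0" "Gamma (\<alpha> * real (Suc r) + \<beta>) > 0"
        using elim assms(1) by (auto simp: algebra_simps intro!: Gamma_real_pos)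
      have "norm (hyp_ML_term \<alpha> \<beta> as bs u (Suc r)) =
          norm (\<rho> r) * norm u * (norm (pochhammer_quot as bs r) * norm u ^ r) * (1 / Gamma (\<alpha> * real (Suc r) + \<beta>))"
        using pos by (simp add: hyp_ML_term_eq \<rho>(2) norm_mult norm_divide norm_power del: of_nat_Suc)
      also have "\<dots> \<le> norm (\<rho> r) * norm u * (norm (pochhammer_quot as bs r) * norm u ^ r) * (h r / Gamma (\<alpha> * real r + \<beta>))"
        unfolding h_def using Gamma_shift_quot_le[OF assms(1) elim] by (intro mult_left_mono) auto
      also have "\<dots> = norm (\<rho> r) * norm u * h r * norm (hyp_ML_term \<alpha> \<beta> as bs u r)"
        using pos by (simp add: hyp_ML_term_eq norm_mult norm_divide norm_power)
      finally show ?case .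
    qed
  qed auto
qed

section \<open>Ratio bounds for the integrated moduli\<close>

text \<open>The \<open>S r\<close> of the overview; the middle factor is the absolute Gaussian
  moment.\<close>

definition hyp_ML_moment :: "real \<Rightarrow> real \<Rightarrow> real \<Rightarrow> complex list \<Rightarrow> complex list \<Rightarrow> nat \<Rightarrow> real" where
  "hyp_ML_moment \<delta> \<alpha> \<beta> as bs r = norm (pochhammer_quot as bs r)
     * (Gamma ((real r + 1) / 2) / \<delta> powr ((real r + 1) / 2)) * (1 / Gamma (\<alpha> * real r + \<beta>))"

lemma hyp_ML_moment_nonneg: "\<alpha> > 0 \<Longrightarrow> \<beta> > 0 \<Longrightarrow> hyp_ML_moment \<delta> \<alpha> \<beta> as bs r \<ge> 0"
  unfolding hyp_ML_moment_def
  by (intro mult_nonneg_nonneg divide_nonneg_nonneg)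
     (auto intro!: less_imp_le[OF Gamma_real_pos] add_nonneg_pos)

text \<open>Raising \<open>r\<close> by 1 shifts the upper Gamma by 1/2, the lower one by \<alpha>
  and the exponent of \<delta> by 1/2; each shift yields one factor.\<close>

lemma hyp_ML_moment_Suc_le:
  assumes "\<alpha> > 0" "\<delta> > 0" "\<alpha> * real r + \<beta> > 1"
    and "pochhammer_quot as bs (Suc r) = \<rho> * pochhammer_quot as bs r"
  shows "hyp_ML_moment \<delta> \<alpha> \<beta> as bs (Suc r) \<le> norm \<rho> * \<delta> powr (-1/2)
     * (((real r + 1) / 2) powr (1/2) * (\<alpha> * real r + \<beta> - 1) powr (-\<alpha>)) * hyp_ML_moment \<delta> \<alpha> \<beta> as bs r"
proof -
  define y where "y = (real r + 1) / 2"
  have y: "y > 0" "(real (Suc r) + 1) / 2 = y + 1/2" by (auto simp: y_def)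
  have pos: "\<alpha> * real (Suc r) + \<beta> > 0"
    using assms(1,3) by (simp add: ring_distribs)
  have "Gamma (y + 1/2) \<le> y powr (1/2) * Gamma y"
    using y by (intro Gamma_real_add_le) auto
  hence "norm (pochhammer_quot as bs (Suc r)) * (Gamma (y + 1/2) / \<delta> powr (y + 1/2)) * (1 / Gamma (\<alpha> * real (Suc r) + \<beta>))
      \<le> norm (pochhammer_quot as bs (Suc r)) * (y powr (1/2) * Gamma y / \<delta> powr (y + 1/2))
        * ((\<alpha> * real r + \<beta> - 1) powr (-\<alpha>) / Gamma (\<alpha> * real r + \<beta>))"
    using assms y pos
    by (intro mult_mono Gamma_shift_quot_le divide_right_mono mult_nonneg_nonneg divide_nonneg_nonneg
          order.refl less_imp_le[OF Gamma_real_pos]) (assumption | simp)+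
  moreover have d: "\<delta> powr (y + 1/2) = \<delta> powr y / \<delta> powr (-1/2)"
    using assms(2) by (simp flip: powr_diff)
  ultimately show ?thesis
    unfolding hyp_ML_moment_def y(2) y_def[symmetric] d
    by (simp add: assms(4) norm_mult mult_ac)
qed

text \<open>The opposite Gamma bounds: \<open>\<alpha> \<le> 1\<close> lets
  \<open>Gamma_real_add_le\<close> handle the lower Gamma, and \<open>r > 1\<close> puts the upper
  argument above 1.\<close>

lemma hyp_ML_moment_Suc_ge:
  assumes "\<alpha> > 0" "\<alpha> \<le> 1" "\<beta> > 0" "\<delta> > 0" "r > 1"
    and "pochhammer_quot as bs (Suc r) = \<rho> * pochhammer_quot as bs r"
  shows "hyp_ML_moment \<delta> \<alpha> \<beta> as bs (Suc r) \<ge> norm \<rho> * \<delta> powr (-1/2)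
     * (((real r - 1) / 2) powr (1/2) * (\<alpha> * real r + \<beta>) powr (-\<alpha>)) * hyp_ML_moment \<delta> \<alpha> \<beta> as bs r"
proof -
  define y where "y = (real r + 1) / 2"
  have y: "y > 1" "(real (Suc r) + 1) / 2 = y + 1/2" "(real r - 1) / 2 = y - 1"
    using assms(5) by (auto simp: y_def field_simps)
  define x where "x = \<alpha> * real r + \<beta>"
  have x: "x > 0" "\<alpha> * real (Suc r) + \<beta> = x + \<alpha>"
    using assms by (auto simp: x_def algebra_simps intro: add_nonneg_pos)
  have "Gamma (y + 1/2) \<ge> (y - 1) powr (1/2) * Gamma y"
    using y by (intro Gamma_real_add_ge) auto
  moreover have "x powr (-\<alpha>) / Gamma x \<le> 1 / Gamma (x + \<alpha>)"
  proof -
    have "Gamma (x + \<alpha>) \<le> x powr \<alpha> * Gamma x"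
      using assms x by (intro Gamma_real_add_le) auto
    hence "1 / (x powr \<alpha> * Gamma x) \<le> 1 / Gamma (x + \<alpha>)"
      using assms x by (intro divide_left_mono mult_pos_pos Gamma_real_pos) auto
    thus ?thesis by (simp add: powr_minus field_simps)
  qed
  ultimately have "norm (pochhammer_quot as bs (Suc r)) * ((y - 1) powr (1/2) * Gamma y / \<delta> powr (y + 1/2)) * (x powr (-\<alpha>) / Gamma x)
     \<le> norm (pochhammer_quot as bs (Suc r)) * (Gamma (y + 1/2) / \<delta> powr (y + 1/2)) * (1 / Gamma (x + \<alpha>))"
    using assms x y
    by (intro mult_mono divide_right_mono mult_nonneg_nonneg divide_nonneg_nonneg
          order.refl less_imp_le[OF Gamma_real_pos]) auto
  moreover have d: "\<delta> powr (y + 1/2) = \<delta> powr y / \<delta> powr (-1/2)"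
    using assms(4) by (simp flip: powr_diff)
  ultimately show ?thesis
    unfolding hyp_ML_moment_def y(2,3) x(2) x_def[symmetric] y_def[symmetric] d
    by (simp add: assms(6) norm_mult mult_ac)
qed

section \<open>Even moments as terms of the right-hand series\<close>

text \<open>Source of both the prefactor \<open>sqrt (pi / \<delta>)\<close> and the extra numerator
  parameter 1/2, through \<open>Gamma (k + 1/2)\<close>.\<close>

lemma gaussian_even_moment_eq:
  assumes "\<delta> > 0"
  shows "Gamma ((real (2 * k) + 1) / 2) / \<delta> powr ((real (2 * k) + 1) / 2)
           = sqrt (pi / \<delta>) * (pochhammer (1/2) k / \<delta> ^ k)"
proof -
  have "Gamma (real k + 1/2) = sqrt pi * pochhammer (1/2) k"
    using pochhammer_Gamma[of "1/2::real" k] nonpos_Ints_nonpos[of "1/2::real"]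
    by (force simp: Gamma_one_half_real field_simps)
  moreover have "\<delta> powr (real k + 1/2) = \<delta> ^ k * sqrt \<delta>"
    using assms by (simp add: powr_add powr_half_sqrt powr_realpow)
  moreover have "(real (2 * k) + 1) / 2 = real k + 1/2" by simp
  ultimately show ?thesis by (simp only:) (simp add: real_sqrt_divide)
qed

text \<open>Index \<open>k\<close> on the right corresponds to index \<open>2 * k\<close> on the
  left, which is why \<alpha> is doubled.\<close>

lemma hyp_ML_term_halves:
  assumes "length as = length bs"
  shows "hyp_ML_term (2 * \<alpha>) \<beta> (halves as @ [1 / 2]) (halves bs) (of_real (1 / \<delta>)) k =
     pochhammer_quot as bs (2 * k) * of_real (pochhammer (1/2) k / \<delta> ^ k / Gamma (\<alpha> * real (2 * k) + \<beta>))"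
proof -
  have "pochhammer_quot (halves as @ [1 / 2]) (halves bs) k = 
      pochhammer_quot (halves as) (halves bs) k * of_real (pochhammer (1/2) k)"
    by (simp add: pochhammer_quot_def flip: pochhammer_of_real)
  thus ?thesis
    by (simp add: hyp_ML_term_eq pochhammer_quot_halves[OF assms] power_divide mult_ac)
qed

lemma hyp_ML_moment_even:
  assumes "length as = length bs" "\<alpha> > 0" "\<beta> > 0" "\<delta> > 0"
  shows "hyp_ML_moment \<delta> \<alpha> \<beta> as bs (2 * k) = sqrt (pi / \<delta>) *
     norm (hyp_ML_term (2 * \<alpha>) \<beta> (halves as @ [1 / 2]) (halves bs) (of_real (1 / \<delta>)) k)"
proof -
  have "pochhammer (1/2::real) k / \<delta> ^ k / Gamma (\<alpha> * real (2 * k) + \<beta>) \<ge> 0"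
    using assms by (intro divide_nonneg_nonneg pochhammer_nonneg less_imp_le[OF Gamma_real_pos] add_nonneg_pos) auto
  from abs_of_nonneg[OF this] show ?thesis
    unfolding hyp_ML_moment_def hyp_ML_term_halves[OF assms(1)] gaussian_even_moment_eq[OF assms(4)]
      norm_mult norm_of_real
    by (simp only:) simp
qed

text \<open>For \<open>2 * \<alpha> = 1\<close> the Gamma factor is
  \<open>Gamma \<beta> * pochhammer \<beta> k\<close>, so \<beta> joins the denominators and
  balances the extra 1/2.\<close>

lemma hyp_ML_term_halves_critical:
  assumes "length as = length bs" "\<beta> > 0"
  shows "hyp_ML_term 1 \<beta> (halves as @ [1 / 2]) (halves bs) 1 k =
     pochhammer_quot (halves as @ [1 / 2]) (halves bs @ [of_real \<beta>]) k / of_real (Gamma \<beta>)"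
proof -
  have "Gamma (real k + \<beta>) = Gamma \<beta> * pochhammer \<beta> k"
    using pochhammer_Gamma[of \<beta> k] nonpos_Ints_nonpos[of \<beta>] assms(2)
    by (cases "\<beta> \<in> \<int>\<^sub>\<le>\<^sub>0") (auto simp: add.commute Gamma_eq_zero_iff)
  thus ?thesis
    by (simp add: hyp_ML_term_eq pochhammer_quot_def pochhammer_of_real mult_ac)
qed

section \<open>Summability of the integrated moduli\<close>

text \<open>The convergence hypothesis sees only even indices and allows conditional convergence;
  the one-step ratio bounds link even and odd indices.\<close>

lemma summable_hyp_ML_moment:
  assumes "\<alpha> > 0" and "\<beta> > 0" and "\<delta> > 0"
    and len: "length as = length bs"
    and bs: "\<And>b. b \<in> set bs \<Longrightarrow> b \<notin> \<int>\<^sub>\<le>\<^sub>0"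
    and summable: "summable (hyp_ML_term (2 * \<alpha>) \<beta> (halves as @ [1 / 2]) (halves bs) (of_real (1 / \<delta>)))"
  shows "summable (hyp_ML_moment \<delta> \<alpha> \<beta> as bs)"
proof -
  define T where "T = hyp_ML_term (2 * \<alpha>) \<beta> (halves as @ [1 / 2]) (halves bs) (of_real (1 / \<delta>))"
  define S where "S = hyp_ML_moment \<delta> \<alpha> \<beta> as bs"
  have S_nonneg: "S r \<ge> 0" for r
    unfolding S_def by (intro hyp_ML_moment_nonneg assms)
  have S_even: "S (2 * k) = sqrt (pi / \<delta>) * norm (T k)" for k
    unfolding S_def T_def by (intro hyp_ML_moment_even assms)
  obtain \<rho> where \<rho>: "\<rho> \<longlonglongrightarrow> 1" "\<And>r. pochhammer_quot as bs (Suc r) = \<rho> r * pochhammer_quot as bs r"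
    using pochhammer_quot_ratio[OF len] by blast
  have norm_\<rho>: "(\<lambda>r. norm (\<rho> r)) \<longlonglongrightarrow> 1"
    using tendsto_norm[OF \<rho>(1)] by simp
  \<comment> \<open>\<open>\<mu> r\<close> bounds \<open>S (Suc r) / S r\<close> from above;
    \<open>\<kappa> r\<close> bounds it from below when \<open>\<alpha> \<le> 1\<close>.\<close>
  define \<mu> where "\<mu> r = norm (\<rho> r) * \<delta> powr (-1/2)
     * (((real r + 1) / 2) powr (1/2) * (\<alpha> * real r + \<beta> - 1) powr (-\<alpha>))" for r
  define \<kappa> where "\<kappa> r = norm (\<rho> r) * \<delta> powr (-1/2)
     * (((real r - 1) / 2) powr (1/2) * (\<alpha> * real r + \<beta>) powr (-\<alpha>))" for r
  have "filterlim (\<lambda>r. \<alpha> * real r + \<beta>) at_top sequentially"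
    using assms(1) by real_asymp
  hence "eventually (\<lambda>r. \<alpha> * real r + \<beta> > 1) sequentially"
    by (auto simp: filterlim_at_top_dense)
  hence S_le: "eventually (\<lambda>r. S (Suc r) \<le> \<mu> r * S r) sequentially"
    unfolding S_def \<mu>_def by eventually_elim (intro hyp_ML_moment_Suc_le assms \<rho>)
  have \<mu>_half: "\<mu> \<longlonglongrightarrow> \<delta> powr (-1/2)" if "\<alpha> = 1/2"
  proof -
    \<comment> \<open>At \<alpha> = 1/2 both bases are asymptotic to \<open>r / 2\<close>, so the
      powers cancel.\<close>
    have "(\<lambda>r. ((real r + 1) / 2) powr (1/2) * (1/2 * real r + \<beta> - 1) powr (-(1/2)))
        \<longlonglongrightarrow> 1"
      by real_asymp (simp flip: powr_add)
    hence "\<mu> \<longlonglongrightarrow> 1 * \<delta> powr (-1/2) * 1"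
      unfolding \<mu>_def that by (intro tendsto_intros norm_\<rho>)
    thus ?thesis by simp
  qed
  \<comment> \<open>The cases may overlap; only the last one excludes terminating coefficients,
    because it needs \<open>S\<close> to be positive.\<close>
  consider "\<exists>a\<in>set as. a \<in> \<int>\<^sub>\<le>\<^sub>0" | "\<alpha> > 1/2" | "\<alpha> = 1/2" "\<delta> > 1" | "\<alpha> = 1/2" "\<delta> = 1"
    | "\<alpha> < 1/2 \<or> \<alpha> = 1/2 \<and> \<delta> < 1" "\<And>a. a \<in> set as \<Longrightarrow> a \<notin> \<int>\<^sub>\<le>\<^sub>0"
    by fastforce
  hence "summable S"
  proof cases
    case 1
    then have "eventually (\<lambda>r. pochhammer_quot as bs r = 0) sequentially"
      using pochhammer_quot_eventually_0[of _ as bs] by auto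
    hence "eventually (\<lambda>r. S r = 0) sequentially"
      by eventually_elim (simp add: S_def hyp_ML_moment_def)
    thus ?thesis by (simp add: summable_cong[of _ "\<lambda>_. 0"])
  next
    case 2
    hence "(\<lambda>r. ((real r + 1) / 2) powr (1/2) * (\<alpha> * real r + \<beta> - 1) powr (-\<alpha>)) \<longlonglongrightarrow> 0"
      by real_asymp
    hence "\<mu> \<longlonglongrightarrow> 1 * \<delta> powr (-1/2) * 0"
      unfolding \<mu>_def by (intro tendsto_intros norm_\<rho>)
    with S_le S_nonneg show ?thesis by (intro summable_ratio_tendsto) auto
  next
    case 3
    have "\<delta> powr (-1/2) < 1"
      using 3 powr_less_mono[of "-1/2" 0 \<delta>] by simp
    with S_le \<mu>_half[OF 3(1)] S_nonneg show ?thesis by (intro summable_ratio_tendsto)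
  next
    case 4
    define P where "P = pochhammer_quot (halves as @ [1 / 2]) (halves bs @ [of_real \<beta>])"
    have T_eq: "T k = P k / of_real (Gamma \<beta>)" for k
      using hyp_ML_term_halves_critical[OF len assms(2)] unfolding T_def P_def 4 by simp
    have \<beta>: "Gamma \<beta> > 0" "complex_of_real \<beta> \<notin> \<int>\<^sub>\<le>\<^sub>0"
      using assms(2) nonpos_Ints_nonpos[of \<beta>] by (auto simp: of_real_in_nonpos_Ints_iff)
    have "P = (\<lambda>k. of_real (Gamma \<beta>) * T k)"
      using \<beta> by (simp add: T_eq fun_eq_iff)
    hence "summable P"
      using summable by (simp add: summable_mult T_def)
    hence "summable (\<lambda>k. norm (P k))"
      unfolding P_def
      using len \<beta>(2) halves_notin_nonpos_Ints[OF bs]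
      by (intro summable_pochhammer_quot_imp_abs_summable) (auto simp: length_halves)
    hence "summable (\<lambda>k. sqrt (pi / \<delta>) * (norm (P k) / Gamma \<beta>))"
      by (intro summable_mult summable_divide)
    hence even: "summable (\<lambda>k. S (2 * k))"
      unfolding S_even T_eq using \<beta> by (simp add: norm_divide)
    \<comment> \<open>Here \<mu> tends to 1, and any larger constant lets even-indexed values
      dominate the odd-indexed ones that follow.\<close>
    have "eventually (\<lambda>r. \<mu> r < 2) sequentially"
      using \<mu>_half 4 by (intro order_tendstoD) auto
    with S_le have "eventually (\<lambda>r. S (Suc r) \<le> 2 * S r) sequentially"
    proof eventually_elim
      case (elim r)
      have "\<mu> r * S r \<le> 2 * S r" using elim S_nonneg[of r] by (intro mult_right_mono) auto
      with elim show ?case by simp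
    qed
    then obtain N where N: "\<And>r. r \<ge> N \<Longrightarrow> S (Suc r) \<le> 2 * S r"
      by (auto simp: eventually_sequentially)
    have odd: "summable (\<lambda>k. S (Suc (2 * k)))"
    proof (rule summable_comparison_test'[where N = N])
      show "summable (\<lambda>k. 2 * S (2 * k))" by (intro summable_mult even)
      show "norm (S (Suc (2 * k))) \<le> 2 * S (2 * k)" if "k \<ge> N" for k
        using that S_nonneg N[of "2 * k"] by simp
    qed
    have "(\<lambda>r. if even r then S (2 * (r div 2)) else S (Suc (2 * ((r - 1) div 2))))
        sums ((\<Sum>k. S (Suc (2 * k))) + (\<Sum>k. S (2 * k)))"
      using sums_if[OF summable_sums[OF odd] summable_sums[OF even]] by simp
    also have "(\<lambda>r. if even r then S (2 * (r div 2)) else S (Suc (2 * ((r - 1) div 2)))) = S"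
      by (auto simp: fun_eq_iff elim!: oddE)
    finally show ?thesis by (rule sums_summable)
  next
    case 5
    define h where "h r = ((real r - 1) / 2) powr (1/2) * (\<alpha> * real r + \<beta>) powr (-\<alpha>)" for r :: nat
    \<comment> \<open>Then \<open>S\<close> is eventually nondecreasing and positive, although its
      even-indexed values are multiples of \<open>norm (T k)\<close>, which tends to 0: a
      contradiction.\<close>
    have "eventually (\<lambda>r. \<kappa> r > 1) sequentially"
    proof (cases "\<alpha> < 1/2")
      case True
      hence "filterlim h at_top sequentially"
        unfolding h_def using assms(1) by real_asymp
      moreover have "(\<lambda>r. norm (\<rho> r) * \<delta> powr (-1/2)) \<longlonglongrightarrow> 1 * \<delta> powr (-1/2)"
        by (intro tendsto_intros norm_\<rho>)
      ultimately have "filterlim \<kappa> at_top sequentially"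
        unfolding \<kappa>_def h_def[symmetric] using assms(3)
        by (intro filterlim_tendsto_pos_mult_at_top[where c = "1 * \<delta> powr (-1/2)"]) auto
      thus ?thesis by (auto simp: filterlim_at_top_dense)
    next
      case False
      hence 6: "\<alpha> = 1/2" "\<delta> < 1" using 5 by auto
      have "(\<lambda>r. ((real r - 1) / 2) powr (1/2) * (1/2 * real r + \<beta>) powr (-(1/2)))
        \<longlonglongrightarrow> 1"
        by real_asymp (simp flip: powr_add)
      hence "\<kappa> \<longlonglongrightarrow> 1 * \<delta> powr (-1/2) * 1"
        unfolding \<kappa>_def 6 by (intro tendsto_intros norm_\<rho>)
      moreover have "\<delta> powr (-1/2) > 1"
        using 6 assms(3) by (simp add: powr_minus powr_half_sqrt field_simps)
      ultimately show ?thesis by (intro order_tendstoD) auto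
    qed
    hence "eventually (\<lambda>r. S r \<le> S (Suc r)) sequentially"
      using eventually_gt_at_top[of 1]
    proof eventually_elim
      case (elim r)
      have "1 * S r \<le> \<kappa> r * S r"
        using elim S_nonneg[of r] by (intro mult_right_mono) auto
      also have "\<dots> \<le> S (Suc r)"
        unfolding S_def \<kappa>_def using 5(1) elim by (intro hyp_ML_moment_Suc_ge assms \<rho>) auto
      finally show ?case by simp
    qed
    then obtain N where N: "\<And>r. r \<ge> N \<Longrightarrow> S r \<le> S (Suc r)"
      by (auto simp: eventually_sequentially)
    have S_ge: "S N \<le> S r" if "r \<ge> N" for r
      using that by (induction r rule: dec_induct) (auto intro: order.trans N)
    have "S N > 0"
      unfolding S_def hyp_ML_moment_def
      using pochhammer_quot_nonzero[OF 5(2) bs] assms(1-3)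
      by (intro mult_pos_pos divide_pos_pos Gamma_real_pos add_nonneg_pos) auto
    have "T \<longlonglongrightarrow> 0"
      using summable unfolding T_def by (rule summable_LIMSEQ_zero)
    hence "(\<lambda>k. S (2 * k)) \<longlonglongrightarrow> sqrt (pi / \<delta>) * norm (0::complex)"
      unfolding S_even by (intro tendsto_intros)
    moreover have "\<forall>k\<ge>N. S N \<le> S (2 * k)"
      by (intro allI impI S_ge) auto
    ultimately have "S N \<le> 0"
      by (intro LIMSEQ_le_const) auto
    with \<open>S N > 0\<close> show ?thesis by simp
  qed
  thus ?thesis by (simp add: S_def)
qed

section \<open>Termwise integration against the Gaussian\<close>

text \<open>The right-hand series diverges for \<open>\<alpha> < 1/2\<close> unless a numerator
  parameter is a non-positive integer, hence the convergence hypothesis. Integrability is asserted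
  separately because the Bochner integral defaults to 0.\<close>

theorem theorem9:
  fixes q :: nat and \<alpha> \<beta> \<delta> :: real and as bs :: "complex list"
  assumes "\<alpha> > 0" and "\<beta> > 0" and "\<delta> > 0"
    and "length as = q" and "length bs = q"
    and "\<And>b. b \<in> set bs \<Longrightarrow> b \<notin> \<int>\<^sub>\<le>\<^sub>0"
    and "summable (hyp_ML_term (2 * \<alpha>) \<beta> (halves as @ [1 / 2]) (halves bs) (of_real (1 / \<delta>)))"
  shows "integrable lborel
           (\<lambda>u::real. of_real (exp (- \<delta> * u\<^sup>2)) * hyp_ML \<alpha> \<beta> as bs (of_real u))
       \<and> (LINT u|lborel. of_real (exp (- \<delta> * u\<^sup>2)) * hyp_ML \<alpha> \<beta> as bs (of_real u))
         = of_real (sqrt (pi / \<delta>))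
           * hyp_ML (2 * \<alpha>) \<beta> (halves as @ [1 / 2]) (halves bs) (of_real (1 / \<delta>))"
proof -
  have len: "length as = length bs" using assms(4,5) by simp
  define T where "T = hyp_ML_term (2 * \<alpha>) \<beta> (halves as @ [1 / 2]) (halves bs) (of_real (1 / \<delta>))"
  define f where "f r u = of_real (exp (- \<delta> * u\<^sup>2)) * hyp_ML_term \<alpha> \<beta> as bs (of_real u) r" for r and u :: real
  \<comment> \<open>Unlike the \<open>c\<close> of the overview, this one absorbs the Gamma
    denominator.\<close>
  define c where "c r = pochhammer_quot as bs r / of_real (Gamma (\<alpha> * real r + \<beta>))" for r
  have f_eq: "f r u = c r * of_real (exp (- \<delta> * u\<^sup>2) * u ^ r)" for r u
    by (simp add: f_def hyp_ML_term_eq c_def)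
  have norm_f_eq: "norm (f r u) = norm (c r) * (exp (- \<delta> * u\<^sup>2) * \<bar>u\<bar> ^ r)" for r u
    unfolding f_eq norm_mult norm_of_real by (simp add: abs_mult power_abs)
  have Gamma_pos: "Gamma (\<alpha> * real r + \<beta>) > 0" for r
    using assms(1,2) by (intro Gamma_real_pos add_nonneg_pos) auto
  have norm_int: "(LINT u|lborel. norm (f r u)) = hyp_ML_moment \<delta> \<alpha> \<beta> as bs r" for r
    using has_bochner_integral_integral_eq[OF gaussian_abs_moment[OF assms(3), of r]] Gamma_pos[of r]
    unfolding norm_f_eq by (simp add: hyp_ML_moment_def c_def norm_divide)
  have f_integrable: "integrable lborel (f r)" for r
  proof (subst integrable_norm_iff[symmetric])
    show "f r \<in> borel_measurable lborel" unfolding f_eq by measurable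
    show "integrable lborel (\<lambda>u. norm (f r u))"
      unfolding norm_f_eq
      by (intro integrable_mult_right integrable.intros[OF gaussian_abs_moment[OF assms(3)]] disjI2)
  qed
  have f_int: "(LINT u|lborel. f r u) = c r * of_real (LINT u|lborel. exp (- \<delta> * u\<^sup>2) * u ^ r)" for r
    unfolding f_eq integral_mult_right_zero integral_complex_of_real ..
  have f_int_odd: "(LINT u|lborel. f r u) = 0" if "odd r" for r
    unfolding f_int gaussian_odd_moment[OF that] by simp
  have f_int_even: "(LINT u|lborel. f (2 * k) u) = of_real (sqrt (pi / \<delta>)) * T k" for k
  proof -
    have "(LINT u|lborel. exp (- \<delta> * u\<^sup>2) * u ^ (2 * k)) = (LINT u|lborel. exp (- \<delta> * u\<^sup>2) * \<bar>u\<bar> ^ (2 * k))"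
      by (simp add: power_even_abs)
    also have "\<dots> = sqrt (pi / \<delta>) * (pochhammer (1/2) k / \<delta> ^ k)"
      using has_bochner_integral_integral_eq[OF gaussian_abs_moment[OF assms(3), of "2 * k"]]
      unfolding gaussian_even_moment_eq[OF assms(3)] .
    finally show ?thesis
      unfolding f_int T_def hyp_ML_term_halves[OF len] c_def by (simp add: mult_ac)
  qed
  have summable_f: "summable (\<lambda>r. norm (f r u))" for u
    unfolding f_def norm_mult by (intro summable_mult abs_summable_hyp_ML assms len)
  have sum_f: "(\<Sum>r. f r u) = of_real (exp (- \<delta> * u\<^sup>2)) * hyp_ML \<alpha> \<beta> as bs (of_real u)" for u
    unfolding f_def hyp_ML_def
    by (intro suminf_mult summable_norm_cancel[OF abs_summable_hyp_ML] assms len)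
  have summable_int: "summable (\<lambda>r. LINT u|lborel. norm (f r u))"
    unfolding norm_int using summable_hyp_ML_moment[OF assms(1-3) len assms(6,7)] by simp
  have AE: "AE u in lborel. summable (\<lambda>r. norm (f r u))"
    by (intro AE_I2 summable_f)
  have "(\<lambda>r. LINT u|lborel. f r u) sums (LINT u|lborel. (\<Sum>r. f r u))"
    by (rule sums_integral[OF f_integrable AE summable_int])
  \<comment> \<open>The odd-indexed integrals vanish, so the series may be reindexed along the even
    numbers.\<close>
  moreover have "strict_mono (\<lambda>k::nat. 2 * k)" by (simp add: strict_mono_def)
  moreover have "(LINT u|lborel. f r u) = 0" if "r \<notin> range (\<lambda>k. 2 * k)" for r
    using that by (intro f_int_odd) (auto elim!: evenE)
  ultimately have "(\<lambda>k. LINT u|lborel. f (2 * k) u) sums (LINT u|lborel. (\<Sum>r. f r u))"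
    using sums_mono_reindex[of "\<lambda>k. 2 * k" "\<lambda>r. LINT u|lborel. f r u"] by blast
  hence "(\<lambda>k. of_real (sqrt (pi / \<delta>)) * T k) sums (LINT u|lborel. (\<Sum>r. f r u))"
    unfolding f_int_even .
  moreover have "(\<lambda>k. of_real (sqrt (pi / \<delta>)) * T k) sums (of_real (sqrt (pi / \<delta>)) * suminf T)"
    using assms(7) unfolding T_def by (intro sums_mult summable_sums)
  ultimately have "(LINT u|lborel. (\<Sum>r. f r u)) = of_real (sqrt (pi / \<delta>)) * suminf T"
    by (rule sums_unique2)
  moreover have "integrable lborel (\<lambda>u. \<Sum>r. f r u)"
    by (rule integrable_suminf[OF f_integrable AE summable_int])
  moreover have "suminf T = hyp_ML (2 * \<alpha>) \<beta> (halves as @ [1 / 2]) (halves bs) (of_real (1 / \<delta>))"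
    unfolding T_def hyp_ML_def ..
  ultimately show ?thesis
    unfolding sum_f by simp
qed

end
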